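(* Let $R$ be a finite commutative chain ring with maximal ideal $\mathfrak{m}$, residue field $R/\mathfrak{m}\cong\mathbb{F}_q$, and nilpotency index $\nu$ of $\mathfrak{m}$ (so $|R|=q^\nu$, $|\mathfrak{m}|=q^{\nu-1}$). Then the uniform matroid $U_{2,n}$ is representable over $R$ if and only if $n\le q^\nu+q^{\nu-1}$. In particular, neither $U_{2,q^\nu+q^{\nu-1}+1}$ nor $U_{q^\nu+q^{\nu-1}-1,\,q^\nu+q^{\nu-1}+1}$ is representable over $R$.
   Context: For a local ring $R$ with maximal ideal $\mathfrak{m}$, vectors $v_1,\dots,v_\ell$ of an $R$-module are modular independent if $\sum\alpha_iv_i=0$ implies all $\alpha_i\in\mathfrak{m}$. For a finite set $E$, an $R$-module $V$ and a map $A\colon E\to V$, $M[A]$ is the independence system on $E$ whose independent sets are the $I\subseteq E$ with $(A(i))_{i\in I}$ modular independent. A matroid $M$ is representable over $R$ if $M$ is isomorphic to $M[A]$ for some finite set $E$ with $|E|=|E(M)|$, some $R$-module $V$ and some $A\colon E\to V$. $U_{k,n}$ denotes the uniform matroid of rank $k$ on $n$ elements. *)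

theory Defs
  imports "HOL-Algebra.Algebra"
begin

locale chain_ring = cring +
  assumes one_not_zero: "\<one> \<noteq> \<zero>"
    and ideals_linear: "ideal I R \<Longrightarrow> ideal J R \<Longrightarrow> I \<subseteq> J \<or> J \<subseteq> I"

definition nilpotency_index :: "('r, 'm) ring_scheme \<Rightarrow> 'r set \<Rightarrow> nat \<Rightarrow> bool" where
  "nilpotency_index R I \<nu> \<longleftrightarrow>
     I [^]\<^bsub>ideals_set R\<^esub> \<nu> = {\<zero>\<^bsub>R\<^esub>} \<and>
     (\<forall>k<\<nu>. I [^]\<^bsub>ideals_set R\<^esub> k \<noteq> {\<zero>\<^bsub>R\<^esub>})"


text \<open>An independence system is a pair of a ground set and its family of independent sets.\<close>

type_synonym 'e indep_system = "'e set \<times> 'e set set"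

abbreviation ground :: "'e indep_system \<Rightarrow> 'e set" where "ground \<equiv> fst"
abbreviation indeps :: "'e indep_system \<Rightarrow> 'e set set" where "indeps \<equiv> snd"

definition indep_system :: "'e indep_system \<Rightarrow> bool" where
  "indep_system M \<longleftrightarrow>
     finite (ground M) \<and> indeps M \<subseteq> Pow (ground M) \<and> {} \<in> indeps M \<and>
     (\<forall>I\<in>indeps M. \<forall>J\<subseteq>I. J \<in> indeps M)"

definition matroid :: "'e indep_system \<Rightarrow> bool" where
  "matroid M \<longleftrightarrow> indep_system M \<and>
     (\<forall>I\<in>indeps M. \<forall>J\<in>indeps M. card I < card J \<longrightarrow> (\<exists>x\<in>J - I. insert x I \<in> indeps M))"

definition isomorphic_systems :: "'e indep_system \<Rightarrow> 'f indep_system \<Rightarrow> bool" where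
  "isomorphic_systems M N \<longleftrightarrow>
     (\<exists>\<phi>. bij_betw \<phi> (ground M) (ground N) \<and>
          (\<forall>I\<subseteq>ground M. I \<in> indeps M \<longleftrightarrow> \<phi> ` I \<in> indeps N))"

text \<open>For \<open>n < k\<close> this is the free matroid, of rank \<open>n\<close>.\<close>

definition uniform_matroid :: "nat \<Rightarrow> nat \<Rightarrow> nat indep_system" where
  "uniform_matroid k n = ({..<n}, {I. I \<subseteq> {..<n} \<and> card I \<le> k})"

lemma matroid_uniform_matroid: "matroid (uniform_matroid k n)"
proof -
  have fin: "finite I" if "I \<subseteq> {..<n}" for I
    using that finite_subset by blast
  have "indep_system (uniform_matroid k n)"
    unfolding indep_system_def uniform_matroid_def
    by (auto dest: fin intro: order_trans[OF card_mono])
  moreover have "\<exists>x\<in>J - I. insert x I \<in> indeps (uniform_matroid k n)"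
    if I: "I \<in> indeps (uniform_matroid k n)" and J: "J \<in> indeps (uniform_matroid k n)"
      and lt: "card I < card J" for I J
  proof -
    have sub: "I \<subseteq> {..<n}" "J \<subseteq> {..<n}" "card J \<le> k"
      using I J by (auto simp: uniform_matroid_def)
    have "\<not> J \<subseteq> I"
      using lt card_mono[OF fin[OF sub(1)]] by (auto simp: not_le[symmetric])
    then obtain x where x: "x \<in> J" "x \<notin> I" by blast
    have "card (insert x I) \<le> k"
      using x fin[OF sub(1)] lt sub(3) by simp
    then show ?thesis
      using x sub by (intro bexI[of _ x]) (auto simp: uniform_matroid_def)
  qed
  ultimately show ?thesis by (simp add: matroid_def)
qed


definition modular_independent ::
    "('r, 'm) ring_scheme \<Rightarrow> 'r set \<Rightarrow> ('r, 'v, 'w) module_scheme \<Rightarrow> ('e \<Rightarrow> 'v) \<Rightarrow> 'e set \<Rightarrow> bool" where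
  "modular_independent R \<mm> V A I \<longleftrightarrow>
     (\<forall>\<alpha> \<in> I \<rightarrow> carrier R.
        (\<Oplus>\<^bsub>V\<^esub>i\<in>I. \<alpha> i \<odot>\<^bsub>V\<^esub> A i) = \<zero>\<^bsub>V\<^esub> \<longrightarrow> (\<forall>i\<in>I. \<alpha> i \<in> \<mm>))"

definition vector_system ::
    "('r, 'm) ring_scheme \<Rightarrow> 'r set \<Rightarrow> ('r, 'v, 'w) module_scheme \<Rightarrow> ('e \<Rightarrow> 'v) \<Rightarrow> 'e set \<Rightarrow> 'e indep_system" where
  "vector_system R \<mm> V A E = (E, {I. I \<subseteq> E \<and> modular_independent R \<mm> V A I})"

text \<open>
  HOL cannot quantify over all modules in a formula, so the type \<open>'v\<close> from which the
  elements of the module are drawn is a parameter. For finite \<open>R\<close> and infinite \<open>'v\<close> the choice is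
  immaterial: only the span of the image of \<open>A\<close> matters, and this finite module has a copy in \<open>'v\<close>.
  Taking the set \<open>E\<close> in the type of the ground
  set of \<open>M\<close> loses nothing, because its cardinality is that of \<open>ground M\<close>.
\<close>

definition representable_over ::
    "'v itself \<Rightarrow> ('r, 'm) ring_scheme \<Rightarrow> 'r set \<Rightarrow> 'e indep_system \<Rightarrow> bool" where
  "representable_over (_ :: 'v itself) R \<mm> M \<longleftrightarrow>
     (\<exists>(E :: 'e set) (V :: ('r, 'v) module) A.
        finite E \<and> card E = card (ground M) \<and> module R V \<and> A \<in> E \<rightarrow> carrier V \<and>
        isomorphic_systems M (vector_system R \<mm> V A E))"

end

theory Submission
  imports Defs
begin

text \<open>
  In a chain ring every pair \<open>(x, y)\<close> is a multiple of a point \<open>(1, a)\<close> or \<open>(b, 1)\<close> with \<open>b \<in> \<mm>\<close>, and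
  there are \<open>|R| + |\<mm>|\<close> such points. Hence among more than \<open>|R| + |\<mm>|\<close> pairs two are multiples
  of the same point.

  A minimal generating subset of a family of vectors is modular independent. If the family
  represents \<open>U\<^bsub>2,n\<^esub>\<close>, it is therefore generated by two of its vectors, and applying the above to the
  coordinates with respect to these gives two vectors that are multiples of a common one, hence one of
  them is a multiple of the other. Conversely the points \<open>(1, a)\<close> and \<open>(b, 1)\<close> in \<open>R\<^sup>2\<close>
  represent \<open>U\<^bsub>2,n\<^esub>\<close>.

  If the family represents \<open>U\<^bsub>n-2,n\<^esub>\<close>, two of its vectors are combinations of the others. This gives
  two relations, and with them a pair of coefficients for every index. If two of these pairs are multiples of one
  point, some combination of the two relations with a unit coefficient vanishes at both indices,
  against the independence of the remaining \<open>n - 2\<close> vectors.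

  Finally \<open>|R| = q\<^sup>\<nu>\<close>, because \<open>|I| = q |I \<mm>|\<close> for every nonzero ideal \<open>I\<close>.
\<close>

section \<open>Finite chain rings\<close>

locale local_chain_ring = chain_ring R + max: maximalideal \<mm> R
  for R (structure) and \<mm>
begin

text \<open>Comparability of the principal ideals \<open>PIdl a\<close> and \<open>PIdl b\<close>,
  read as divisibility. This is the form in which the chain condition enters the coordinate
  arguments.\<close>

lemma dvd_linear:
  assumes "a \<in> carrier R" "b \<in> carrier R"
  shows "(\<exists>r\<in>carrier R. a = r \<otimes> b) \<or> (\<exists>r\<in>carrier R. b = r \<otimes> a)"
proof -
  have "PIdl a \<subseteq> PIdl b \<or> PIdl b \<subseteq> PIdl a"
    using assms by (intro ideals_linear cgenideal_ideal)
  then have "a \<in> PIdl b \<or> b \<in> PIdl a"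
    using assms cgenideal_self by blast
  then show ?thesis
    by (auto simp: cgenideal_def)
qed

lemma maxideal_subset: "\<mm> \<subseteq> carrier R"
  by (rule max.a_subset)

lemma one_notin_maxideal: "\<one> \<notin> \<mm>"
  using max.I_notcarr max.one_imp_carrier by blast

lemma card_carrier_maxideal_pos:
  assumes "finite (carrier R)"
  shows "0 < card (carrier R)" "0 < card \<mm>"
  unfolding card_gt_0_iff
  using assms finite_subset[OF maxideal_subset assms] max.zero_closed zero_closed by blast+

text \<open>A nonunit generates a proper ideal. That ideal is comparable with \<open>\<mm>\<close>,
  and by maximality it cannot lie strictly above it.\<close>

lemma nonunit_in_maxideal:
  assumes a: "a \<in> carrier R" "a \<notin> Units R" shows "a \<in> \<mm>"
proof -
  have id: "ideal (PIdl a) R"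
    using a by (intro cgenideal_ideal)
  have "PIdl a \<noteq> carrier R"
  proof
    assume "PIdl a = carrier R"
    then obtain r where "r \<in> carrier R" "\<one> = r \<otimes> a"
      unfolding cgenideal_def using one_closed by blast
    then show False
      using a m_comm by (auto simp: Units_def)
  qed
  moreover have "PIdl a \<subseteq> carrier R"
    using id by (simp add: additive_subgroup.a_subset ideal_def)
  ultimately have "PIdl a \<subseteq> \<mm>"
    using ideals_linear[OF id max.is_ideal] max.I_maximal[OF id] by blast
  then show ?thesis
    using cgenideal_self a by blast
qed

text \<open>A unit annihilates no nonzero element.\<close>

lemma annihilator_in_maxideal:
  assumes "r \<in> carrier R" "x \<in> carrier R" "x \<noteq> \<zero>" "r \<otimes> x = \<zero>"
  shows "r \<in> \<mm>"
proof (rule nonunit_in_maxideal)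
  show "r \<notin> Units R"
  proof
    assume r: "r \<in> Units R"
    have "x = inv r \<otimes> (r \<otimes> x)"
      using assms(1,2) r by (simp add: m_assoc[symmetric] Units_l_inv)
    then show False using assms r by simp
  qed
qed fact

section \<open>Cardinalities of ideals and of the powers of the maximal ideal\<close>

text \<open>The principal ideals inside \<open>I\<close> form a finite chain, so a largest one
  contains all others and hence every element of \<open>I\<close>.\<close>

lemma finite_ideal_principal:
  assumes "finite (carrier R)" "ideal I R"
  obtains x where "x \<in> I" "I = PIdl x"
proof -
  interpret I: ideal I R by fact
  note sub = I.a_subset
  have fin: "finite (PIdl x)" if "x \<in> I" for x
    using assms(1) by (simp add: cgenideal_def)
  have "finite I" "I \<noteq> {}"
    using finite_subset[OF sub assms(1)] I.zero_closed by blast+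
  then have "Max ((\<lambda>y. card (PIdl y)) ` I) \<in> (\<lambda>y. card (PIdl y)) ` I"
    by (intro Max_in) auto
  then obtain x where x: "x \<in> I" and xM: "Max ((\<lambda>y. card (PIdl y)) ` I) = card (PIdl x)"
    by (rule imageE)
  have xmax: "card (PIdl y) \<le> card (PIdl x)" if "y \<in> I" for y
    unfolding xM[symmetric] using that \<open>finite I\<close> by (intro Max_ge) auto
  have "y \<in> PIdl x" if y: "y \<in> I" for y
  proof -
    have "PIdl y \<subseteq> PIdl x \<or> PIdl x \<subseteq> PIdl y"
      using x y sub by (intro ideals_linear cgenideal_ideal) auto
    then have "PIdl y \<subseteq> PIdl x"
      using card_seteq[OF fin[OF y] _ xmax[OF y]] by blast
    then show ?thesis
      using cgenideal_self y sub by blast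
  qed
  then have "I = PIdl x"
    using cgenideal_minimal[OF assms(2) x] by blast
  with x that show ?thesis by blast
qed

text \<open>First isomorphism theorem for multiplication by \<open>x\<close>. Since \<open>H\<close>
  contains the full annihilator of \<open>x\<close>, the kernel does not depend on \<open>H\<close>;
  this makes the counts for \<open>carrier R\<close> and for \<open>\<mm>\<close>
  comparable.\<close>

lemma card_mult_image:
  assumes "finite (carrier R)" "x \<in> carrier R" "ideal H R"
    and ann: "\<And>r. r \<in> carrier R \<Longrightarrow> r \<otimes> x = \<zero> \<Longrightarrow> r \<in> H"
  shows "card H = card ((\<lambda>r. r \<otimes> x) ` H) * card {r \<in> carrier R. r \<otimes> x = \<zero>}"
proof -
  interpret H: ideal H R by fact
  have sub: "H \<subseteq> carrier R" by (rule H.a_subset)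
  have finH: "finite H" using sub assms(1) finite_subset by blast
  have "card {h \<in> H. h \<otimes> x = y} = card {r \<in> carrier R. r \<otimes> x = \<zero>}"
    if y: "y \<in> (\<lambda>r. r \<otimes> x) ` H" for y
  proof -
    obtain h0 where h0: "h0 \<in> H" "y = h0 \<otimes> x" using y by blast
    have h0c: "h0 \<in> carrier R" using h0 sub by blast
    \<comment> \<open>The fibre over \<open>y\<close> is the coset of the annihilator through
      \<open>h0\<close>.\<close>
    have "bij_betw (\<lambda>r. r \<oplus> h0) {r \<in> carrier R. r \<otimes> x = \<zero>} {h \<in> H. h \<otimes> x = y}"
    proof (rule bij_betw_byWitness[where f' = "\<lambda>h. h \<ominus> h0"])
      show "\<forall>r\<in>{r \<in> carrier R. r \<otimes> x = \<zero>}. r \<oplus> h0 \<ominus> h0 = r"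
        using h0c by (simp add: minus_eq a_assoc r_neg)
      show "\<forall>h\<in>{h \<in> H. h \<otimes> x = y}. h \<ominus> h0 \<oplus> h0 = h"
        using h0c by (simp add: minus_eq a_assoc l_neg)
      show "(\<lambda>r. r \<oplus> h0) ` {r \<in> carrier R. r \<otimes> x = \<zero>} \<subseteq> {h \<in> H. h \<otimes> x = y}"
      proof (intro image_subsetI CollectI conjI; elim CollectE conjE)
        fix r assume r: "r \<in> carrier R" "r \<otimes> x = \<zero>"
        show "r \<oplus> h0 \<in> H" using ann[OF r] h0(1) by (rule H.a_closed)
        show "(r \<oplus> h0) \<otimes> x = y" using r h0(2) h0c assms(2) by (simp add: l_distr)
      qed
      show "(\<lambda>h. h \<ominus> h0) ` {h \<in> H. h \<otimes> x = y} \<subseteq> {r \<in> carrier R. r \<otimes> x = \<zero>}"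
      proof (intro image_subsetI CollectI conjI; elim CollectE conjE)
        fix h assume h: "h \<in> H" "h \<otimes> x = y"
        show "h \<ominus> h0 \<in> carrier R" using h h0c by simp
        show "(h \<ominus> h0) \<otimes> x = \<zero>"
          using h h0(2) h0c assms(2) by (simp add: minus_eq l_distr l_minus r_neg)
      qed
    qed
    then show ?thesis by (rule bij_betw_same_card[symmetric])
  qed
  moreover have "card H = (\<Sum>y\<in>(\<lambda>r. r \<otimes> x) ` H. card {h \<in> H. h \<otimes> x = y})"
    using sum.image_gen[OF finH, of "\<lambda>_. 1::nat" "\<lambda>r. r \<otimes> x"] by simp
  ultimately show ?thesis by simp
qed

lemma ideal_prod_principal:
  assumes "x \<in> carrier R" "ideal J R"
  shows "(PIdl x) \<cdot> J = (\<lambda>r. r \<otimes> x) ` J"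
proof -
  interpret J: ideal J R by fact
  note sub = J.a_subset
  show ?thesis
  proof (intro equalityI subsetI)
    fix z assume "z \<in> (PIdl x) \<cdot> J"
    then show "z \<in> (\<lambda>r. r \<otimes> x) ` J"
    proof induction
      case (prod i j)
      then obtain r where r: "r \<in> carrier R" "i = r \<otimes> x" by (auto simp: cgenideal_def)
      have "i \<otimes> j = (r \<otimes> j) \<otimes> x"
        using r prod sub assms(1) by (auto simp: m_ac)
      moreover have "r \<otimes> j \<in> J" using r prod by (intro J.I_l_closed)
      ultimately show ?case by blast
    next
      case (sum s1 s2)
      then obtain r1 r2 where r: "r1 \<in> J" "s1 = r1 \<otimes> x" "r2 \<in> J" "s2 = r2 \<otimes> x" by blast
      have "s1 \<oplus> s2 = (r1 \<oplus> r2) \<otimes> x" using r assms(1) sub by (simp add: l_distr subset_iff)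
      then show ?case using r J.a_closed by blast
    qed
  next
    fix z assume "z \<in> (\<lambda>r. r \<otimes> x) ` J"
    then obtain j where j: "j \<in> J" "z = x \<otimes> j" using assms(1) sub m_comm by auto
    then show "z \<in> (PIdl x) \<cdot> J" using cgenideal_self[OF assms(1)] by (auto intro: ideal_prod.prod)
  qed
qed

text \<open>With \<open>I = PIdl x\<close>, multiplication by \<open>x\<close> maps
  \<open>carrier R\<close> onto \<open>I\<close> and \<open>\<mm>\<close> onto the product. Both
  maps have the annihilator of \<open>x\<close> as kernel, as it lies in \<open>\<mm>\<close> for
  nonzero \<open>x\<close>.\<close>

lemma card_ideal_prod_maxideal:
  assumes "finite (carrier R)" "ideal I R" "I \<noteq> {\<zero>}"
  shows "card I * card \<mm> = card (carrier R) * card (I \<cdot> \<mm>)"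
proof -
  obtain x where x: "x \<in> I" "I = PIdl x"
    using finite_ideal_principal assms by blast
  have xc: "x \<in> carrier R"
    using ideal.Icarr[OF assms(2) x(1)] .
  have x0: "x \<noteq> \<zero>"
  proof
    assume "x = \<zero>"
    then have "I = {\<zero>}" using x(2) by (auto simp: cgenideal_def intro: exI[of _ \<one>])
    then show False using assms(3) by contradiction
  qed
  have ann: "r \<in> \<mm>" if "r \<in> carrier R" "r \<otimes> x = \<zero>" for r
    using annihilator_in_maxideal that x0 xc by blast
  have "I = (\<lambda>r. r \<otimes> x) ` carrier R"
    using x(2) by (auto simp: cgenideal_def)
  then show ?thesis
    using card_mult_image[OF assms(1) xc oneideal]
      card_mult_image[OF assms(1) xc max.is_ideal ann]
      ideal_prod_principal[OF xc max.is_ideal] x(2)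
    by simp
qed

text \<open>Each further factor \<open>\<mm>\<close> divides the cardinality by \<open>q\<close> as
  long as the current power is nonzero. The bound \<open>k \<le> \<nu>\<close> ensures this, and for
  the zero ideal the division would fail.\<close>

lemma card_maxideal_pow:
  assumes fin: "finite (carrier R)" and q: "card (carrier R) = q * card \<mm>"
    and "nilpotency_index R \<mm> \<nu>" "k \<le> \<nu>"
  shows "card (carrier R) = q ^ k * card (\<mm> [^]\<^bsub>ideals_set R\<^esub> k)"
  using \<open>k \<le> \<nu>\<close>
proof (induction k)
  case 0
  then show ?case by (simp add: ideals_set_def nat_pow_def)
next
  case (Suc k)
  interpret S: comm_monoid "ideals_set R" by (rule ideals_set_is_comm_monoid)
  let ?I = "\<mm> [^]\<^bsub>ideals_set R\<^esub> k"
  have "\<mm> \<in> carrier (ideals_set R)"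
    using max.is_ideal by (simp add: ideals_set_def)
  then have "?I \<in> carrier (ideals_set R)" by (rule S.nat_pow_closed)
  then have I: "ideal ?I R" by (simp add: ideals_set_def)
  have "?I \<noteq> {\<zero>}" using assms(3) Suc.prems by (auto simp: nilpotency_index_def)
  then have "card ?I * card \<mm> = card (carrier R) * card (?I \<cdot> \<mm>)"
    using I fin by (intro card_ideal_prod_maxideal)
  moreover have "\<mm> [^]\<^bsub>ideals_set R\<^esub> Suc k = ?I \<cdot> \<mm>"
    by (simp add: ideals_set_def nat_pow_def)
  ultimately have "card ?I = q * card (\<mm> [^]\<^bsub>ideals_set R\<^esub> Suc k)"
    using q card_carrier_maxideal_pos(2)[OF fin] by simp
  then show ?case using Suc by simp
qed

lemma card_from_nilpotency_index:
  assumes fin: "finite (carrier R)" and q: "card (carrier R) = q * card \<mm>"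
    and nil: "nilpotency_index R \<mm> \<nu>"
  shows "card (carrier R) = q ^ \<nu>" "card \<mm> = q ^ (\<nu> - 1)"
proof -
  show 1: "card (carrier R) = q ^ \<nu>"
    using card_maxideal_pow[OF fin q nil order_refl] nil by (simp add: nilpotency_index_def)
  have "carrier R \<noteq> {\<zero>}" using one_not_zero one_closed by blast
  \<comment> \<open>The zeroth power is the whole ring, which is not \<open>{\<zero>}\<close>; hence
    \<open>\<nu> - 1\<close> is a true subtraction.\<close>
  then have "\<nu> \<noteq> 0" using nil by (auto simp: nilpotency_index_def ideals_set_def nat_pow_def)
  moreover have "q \<noteq> 0"
    using q fin one_closed by (metis card_eq_0_iff empty_iff mult_0)
  ultimately show "card \<mm> = q ^ (\<nu> - 1)"
    using 1 q by (cases \<nu>) auto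
qed

text \<open>Lagrange's theorem for the additive subgroup \<open>\<mm>\<close>, whose cosets are the
  elements of the quotient.\<close>

lemma card_carrier_eq_residue_field:
  assumes "finite (carrier R)" "R Quot \<mm> \<simeq> F"
  shows "card (carrier R) = card (carrier F) * card \<mm>"
proof -
  have "card (carrier (R Quot \<mm>)) = card (carrier F)"
    using assms(2) bij_betw_same_card unfolding is_ring_iso_def ring_iso_def by blast
  moreover have "card (a_rcosets \<mm>) * card \<mm> = card (carrier R)"
    using a_lagrange[OF assms(1) max.is_additive_subgroup] by (simp add: order_def)
  ultimately show ?thesis by (simp add: FactRing_def)
qed

text \<open>The points of the projective line over \<open>R\<close>, each given by its normalised coordinates.\<close>

definition proj_line :: "('a \<times> 'a) set" where
  "proj_line = (\<lambda>a. (\<one>, a)) ` carrier R \<union> (\<lambda>b. (b, \<one>)) ` \<mm>"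

lemma card_proj_line:
  assumes "finite (carrier R)"
  shows "finite proj_line" "card proj_line = card (carrier R) + card \<mm>"
proof -
  have fin: "finite \<mm>" using assms maxideal_subset finite_subset by blast
  then show "finite proj_line" using assms by (simp add: proj_line_def)
  have "(\<lambda>a. (\<one>, a)) ` carrier R \<inter> (\<lambda>b. (b, \<one>)) ` \<mm> = {}"
    using one_notin_maxideal by auto
  then show "card proj_line = card (carrier R) + card \<mm>"
    using assms fin by (simp add: proj_line_def card_Un_disjoint card_image inj_on_def)
qed

text \<open>One coordinate divides the other. If \<open>x\<close> divides \<open>y\<close>, a point
  \<open>(1, a)\<close> serves; otherwise \<open>x = b y\<close>, and \<open>b\<close> cannot be a
  unit, since its inverse would make \<open>y\<close> a multiple of \<open>x\<close>.\<close>

lemma proj_line_cover: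
  assumes "x \<in> carrier R" "y \<in> carrier R"
  shows "\<exists>(u, v)\<in>proj_line. \<exists>r\<in>carrier R. x = r \<otimes> u \<and> y = r \<otimes> v"
proof (cases "\<exists>a\<in>carrier R. y = a \<otimes> x")
  case True
  then obtain a where "a \<in> carrier R" "y = a \<otimes> x" by blast
  then show ?thesis
    using assms by (intro bexI[of _ "(\<one>, a)"]) (auto simp: proj_line_def m_comm)
next
  case False
  then obtain b where b: "b \<in> carrier R" "x = b \<otimes> y" using dvd_linear assms by blast
  have "b \<notin> Units R"
  proof
    assume "b \<in> Units R"
    then have "y = inv b \<otimes> x" using b assms by (simp add: m_assoc[symmetric] Units_l_inv)
    with False \<open>b \<in> Units R\<close> show False by blast
  qed
  then have "b \<in> \<mm>" using b nonunit_in_maxideal by blast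
  then show ?thesis
    using assms b by (intro bexI[of _ "(b, \<one>)"]) (auto simp: proj_line_def m_comm)
qed

text \<open>Serves both bounds: \<open>f\<close> and \<open>g\<close> are coordinates with respect
  to two generators in the one, and the coefficients of two relations in the other.\<close>

lemma proj_line_pigeonhole:
  assumes "finite (carrier R)" "card (carrier R) + card \<mm> < card E"
    and f: "f \<in> E \<rightarrow> carrier R" and g: "g \<in> E \<rightarrow> carrier R"
  obtains i j u v r s where "i \<in> E" "j \<in> E" "i \<noteq> j" "(u, v) \<in> proj_line"
    "r \<in> carrier R" "s \<in> carrier R"
    "f i = r \<otimes> u" "g i = r \<otimes> v" "f j = s \<otimes> u" "g j = s \<otimes> v"
proof -
  \<comment> \<open>The point need not be unique: the zero pair is a multiple of each of them.
    \<open>P\<close> selects one per index.\<close>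
  have "\<forall>i\<in>E. \<exists>p. p \<in> proj_line \<and> (\<exists>r\<in>carrier R. f i = r \<otimes> fst p \<and> g i = r \<otimes> snd p)"
    using proj_line_cover[OF funcset_mem[OF f] funcset_mem[OF g]] by fastforce
  then obtain P where P: "\<And>i. i \<in> E \<Longrightarrow> P i \<in> proj_line"
    "\<And>i. i \<in> E \<Longrightarrow> \<exists>r\<in>carrier R. f i = r \<otimes> fst (P i) \<and> g i = r \<otimes> snd (P i)"
    by metis
  have "\<not> inj_on P E"
    using P(1) card_proj_line[OF assms(1)] assms(2)
    by (metis card_inj_on_le image_subsetI not_le)
  then obtain i j where ij: "i \<in> E" "j \<in> E" "i \<noteq> j" "P i = P j"
    by (auto simp: inj_on_def)
  then show ?thesis
    using P(2)[of i] P(2)[of j] P(1)[of i] that[of i j "fst (P i)" "snd (P i)"] by auto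
qed

lemma proj_line_closed:
  assumes "(u, v) \<in> proj_line"
  shows "u \<in> carrier R" "v \<in> carrier R" "u = \<one> \<or> v = \<one>"
  using assms maxideal_subset by (auto simp: proj_line_def)

section \<open>Linear relations between two and three points of the projective line\<close>

text \<open>Cramer's rule: both coefficients annihilate the determinant \<open>?d\<close>. It may be
  a zero divisor, but it is nonzero for distinct normalised points, and that suffices to put its
  annihilator inside \<open>\<mm>\<close>.\<close>

lemma proj_line_pair_relation:
  assumes "(u, v) \<in> proj_line" "(w, z) \<in> proj_line" "(u, v) \<noteq> (w, z)"
    and ab: "a \<in> carrier R" "b \<in> carrier R"
    and eq: "a \<otimes> u \<oplus> b \<otimes> w = \<zero>" "a \<otimes> v \<oplus> b \<otimes> z = \<zero>"
  shows "a \<in> \<mm>" "b \<in> \<mm>"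
proof -
  note c = proj_line_closed[OF assms(1)] proj_line_closed[OF assms(2)]
  let ?d = "u \<otimes> z \<ominus> v \<otimes> w"
  have 1: "a \<otimes> ?d = z \<otimes> (a \<otimes> u \<oplus> b \<otimes> w) \<ominus> w \<otimes> (a \<otimes> v \<oplus> b \<otimes> z)"
    using c(1,2,4,5) ab by algebra
  have 2: "b \<otimes> ?d = u \<otimes> (a \<otimes> v \<oplus> b \<otimes> z) \<ominus> v \<otimes> (a \<otimes> u \<oplus> b \<otimes> w)"
    using c(1,2,4,5) ab by algebra
  have ann: "a \<otimes> ?d = \<zero>" "b \<otimes> ?d = \<zero>"
    using 1 2 eq c by (simp_all add: minus_eq)
  have d0: "?d \<noteq> \<zero>"
  proof
    assume "?d = \<zero>"
    then have e: "u \<otimes> z = v \<otimes> w" using c by (simp add: r_right_minus_eq)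
    \<comment> \<open>Settles the mixed case: for points \<open>(1, a)\<close> and
      \<open>(b, 1)\<close>, a vanishing determinant would make the product of \<open>a\<close> and
      \<open>b\<close> equal to one, although \<open>b\<close> lies in \<open>\<mm>\<close>.\<close>
    have "u' \<otimes> z' \<noteq> \<one>" "z' \<otimes> u' \<noteq> \<one>" if "u' \<in> \<mm>" "z' \<in> carrier R" for u' z'
      using that max.I_r_closed max.I_l_closed one_notin_maxideal by metis+
    note this[simp] this[symmetric, simp]
    show False
      using assms(1-3) e c by (auto simp: proj_line_def)
  qed
  have "?d \<in> carrier R" using c by simp
  with ann ab d0 show "a \<in> \<mm>" "b \<in> \<mm>"
    using annihilator_in_maxideal by blast+
qed

text \<open>Elimination with the pivot \<open>(1, v)\<close>: it reduces \<open>(w, z)\<close> and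
  \<open>(x, y)\<close> to pairs with first coordinate zero. Of the two remaining second coordinates
  one is a multiple of the other, and the multiple receives coefficient one.\<close>

lemma triple_relation_pivot_one:
  assumes c: "v \<in> carrier R" "w \<in> carrier R" "z \<in> carrier R" "x \<in> carrier R" "y \<in> carrier R"
  shows "\<exists>a\<in>carrier R. \<exists>b\<in>carrier R. \<exists>c\<in>carrier R. (b = \<one> \<or> c = \<one>) \<and>
    a \<oplus> (b \<otimes> w \<oplus> c \<otimes> x) = \<zero> \<and> a \<otimes> v \<oplus> (b \<otimes> z \<oplus> c \<otimes> y) = \<zero>"
proof -
  have "(\<exists>r\<in>carrier R. z \<ominus> w \<otimes> v = r \<otimes> (y \<ominus> x \<otimes> v)) \<or> (\<exists>r\<in>carrier R. y \<ominus> x \<otimes> v = r \<otimes> (z \<ominus> w \<otimes> v))"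
    using c by (intro dvd_linear) auto
  then show ?thesis
  proof (elim disjE bexE)
    fix r assume r: "r \<in> carrier R" "z \<ominus> w \<otimes> v = r \<otimes> (y \<ominus> x \<otimes> v)"
    \<comment> \<open>The coefficient of the pivot is forced by the first equation.\<close>
    have "(r \<otimes> x \<ominus> w) \<oplus> (\<one> \<otimes> w \<oplus> (\<ominus> r) \<otimes> x) = \<zero>"
      using r(1) c by algebra
    moreover have "(r \<otimes> x \<ominus> w) \<otimes> v \<oplus> (\<one> \<otimes> z \<oplus> (\<ominus> r) \<otimes> y) = (z \<ominus> w \<otimes> v) \<ominus> r \<otimes> (y \<ominus> x \<otimes> v)"
      using r(1) c by algebra
    moreover have "\<dots> = \<zero>" using r c by (simp add: r_right_minus_eq)
    ultimately show ?thesis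
      using r(1) c by (intro bexI[of _ "r \<otimes> x \<ominus> w"] bexI[of _ "\<one>"] bexI[of _ "\<ominus> r"]) auto
  next
    fix r assume r: "r \<in> carrier R" "y \<ominus> x \<otimes> v = r \<otimes> (z \<ominus> w \<otimes> v)"
    have "(r \<otimes> w \<ominus> x) \<oplus> ((\<ominus> r) \<otimes> w \<oplus> \<one> \<otimes> x) = \<zero>"
      using r(1) c by algebra
    moreover have "(r \<otimes> w \<ominus> x) \<otimes> v \<oplus> ((\<ominus> r) \<otimes> z \<oplus> \<one> \<otimes> y) = (y \<ominus> x \<otimes> v) \<ominus> r \<otimes> (z \<ominus> w \<otimes> v)"
      using r(1) c by algebra
    moreover have "\<dots> = \<zero>" using r c by (simp add: r_right_minus_eq)
    ultimately show ?thesis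
      using r(1) c by (intro bexI[of _ "r \<otimes> w \<ominus> x"] bexI[of _ "\<ominus> r"] bexI[of _ "\<one>"]) auto
  qed
qed

text \<open>One coordinate of a normalised point is one and can act as pivot; if it is the second,
  the coordinates are exchanged.\<close>

lemma proj_line_triple_relation:
  assumes "(u, v) \<in> proj_line" and c: "w \<in> carrier R" "z \<in> carrier R" "x \<in> carrier R" "y \<in> carrier R"
  shows "\<exists>a\<in>carrier R. \<exists>b\<in>carrier R. \<exists>c\<in>carrier R. (b = \<one> \<or> c = \<one>) \<and>
    a \<otimes> u \<oplus> (b \<otimes> w \<oplus> c \<otimes> x) = \<zero> \<and> a \<otimes> v \<oplus> (b \<otimes> z \<oplus> c \<otimes> y) = \<zero>"
  using proj_line_closed(3)[OF assms(1)]
proof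
  assume "u = \<one>"
  then show ?thesis
    using triple_relation_pivot_one[of v w z x y] proj_line_closed[OF assms(1)] c by fastforce
next
  assume "v = \<one>"
  then show ?thesis
    using triple_relation_pivot_one[of u z w y x] proj_line_closed[OF assms(1)] c by fastforce
qed

end

section \<open>Linear combinations and modular independence\<close>

context module
begin

text \<open>Stated for an indexed family, as \<open>modular_independent\<close> is, so that repeated
  vectors count separately.\<close>

definition lincombs :: "('e \<Rightarrow> 'c) \<Rightarrow> 'e set \<Rightarrow> 'c set" where
  "lincombs v I = {(\<Oplus>\<^bsub>M\<^esub>i\<in>I. \<alpha> i \<odot>\<^bsub>M\<^esub> v i) | \<alpha>. \<alpha> \<in> I \<rightarrow> carrier R}"

lemma lincombsI: "\<alpha> \<in> I \<rightarrow> carrier R \<Longrightarrow> (\<Oplus>\<^bsub>M\<^esub>i\<in>I. \<alpha> i \<odot>\<^bsub>M\<^esub> v i) \<in> lincombs v I"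
  by (auto simp: lincombs_def)

lemma lincomb_lincomb:
  assumes "finite I" "v \<in> I \<rightarrow> carrier M" "\<alpha> \<in> I \<rightarrow> carrier R" "\<beta> \<in> I \<rightarrow> carrier R"
    "r \<in> carrier R" "s \<in> carrier R"
  shows "r \<odot>\<^bsub>M\<^esub> (\<Oplus>\<^bsub>M\<^esub>i\<in>I. \<alpha> i \<odot>\<^bsub>M\<^esub> v i) \<oplus>\<^bsub>M\<^esub> s \<odot>\<^bsub>M\<^esub> (\<Oplus>\<^bsub>M\<^esub>i\<in>I. \<beta> i \<odot>\<^bsub>M\<^esub> v i) =
    (\<Oplus>\<^bsub>M\<^esub>i\<in>I. (r \<otimes> \<alpha> i \<oplus> s \<otimes> \<beta> i) \<odot>\<^bsub>M\<^esub> v i)"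
proof -
  have mem: "v i \<in> carrier M" "\<alpha> i \<in> carrier R" "\<beta> i \<in> carrier R" if "i \<in> I" for i
    using assms that by auto
  have "r \<odot>\<^bsub>M\<^esub> (\<Oplus>\<^bsub>M\<^esub>i\<in>I. \<alpha> i \<odot>\<^bsub>M\<^esub> v i) \<oplus>\<^bsub>M\<^esub> s \<odot>\<^bsub>M\<^esub> (\<Oplus>\<^bsub>M\<^esub>i\<in>I. \<beta> i \<odot>\<^bsub>M\<^esub> v i) =
    (\<Oplus>\<^bsub>M\<^esub>i\<in>I. r \<odot>\<^bsub>M\<^esub> (\<alpha> i \<odot>\<^bsub>M\<^esub> v i)) \<oplus>\<^bsub>M\<^esub> (\<Oplus>\<^bsub>M\<^esub>i\<in>I. s \<odot>\<^bsub>M\<^esub> (\<beta> i \<odot>\<^bsub>M\<^esub> v i))"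
    using assms(1,5,6) mem by (subst (1 2) finsum_smult_ldistr) auto
  also have "\<dots> = (\<Oplus>\<^bsub>M\<^esub>i\<in>I. r \<odot>\<^bsub>M\<^esub> (\<alpha> i \<odot>\<^bsub>M\<^esub> v i) \<oplus>\<^bsub>M\<^esub> s \<odot>\<^bsub>M\<^esub> (\<beta> i \<odot>\<^bsub>M\<^esub> v i))"
    using assms(5,6) mem by (intro M.finsum_addf[symmetric]) auto
  also have "\<dots> = (\<Oplus>\<^bsub>M\<^esub>i\<in>I. (r \<otimes> \<alpha> i \<oplus> s \<otimes> \<beta> i) \<odot>\<^bsub>M\<^esub> v i)"
    using assms(5,6) mem by (intro M.finsum_cong') (auto simp: smult_l_distr smult_assoc1)
  finally show ?thesis .
qed

lemma lincombs_closed: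
  assumes "finite I" "v \<in> I \<rightarrow> carrier M" "x \<in> lincombs v I" "y \<in> lincombs v I"
    "r \<in> carrier R" "s \<in> carrier R"
  shows "r \<odot>\<^bsub>M\<^esub> x \<oplus>\<^bsub>M\<^esub> s \<odot>\<^bsub>M\<^esub> y \<in> lincombs v I"
proof -
  obtain \<alpha> \<beta> where ab: "\<alpha> \<in> I \<rightarrow> carrier R" "x = (\<Oplus>\<^bsub>M\<^esub>i\<in>I. \<alpha> i \<odot>\<^bsub>M\<^esub> v i)"
    "\<beta> \<in> I \<rightarrow> carrier R" "y = (\<Oplus>\<^bsub>M\<^esub>i\<in>I. \<beta> i \<odot>\<^bsub>M\<^esub> v i)"
    using assms(3,4) by (auto simp: lincombs_def)
  show ?thesis
    unfolding ab(2,4) lincomb_lincomb[OF assms(1,2) ab(1,3) assms(5,6)]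
    using ab(1,3) assms(5,6) by (intro lincombsI) auto
qed

lemma lincombs_carrier:
  assumes "v \<in> I \<rightarrow> carrier M"
  shows "lincombs v I \<subseteq> carrier M"
  using assms by (auto simp: lincombs_def Pi_iff intro!: M.finsum_closed)

text \<open>Transfers combinations and relations from a subfamily to the whole family; monotonicity
  of spans and heredity of independence both rest on it.\<close>

lemma lincomb_extend_zero:
  assumes "finite I" "J \<subseteq> I" "v \<in> I \<rightarrow> carrier M" "\<alpha> \<in> J \<rightarrow> carrier R"
  shows "(\<Oplus>\<^bsub>M\<^esub>i\<in>I. (if i \<in> J then \<alpha> i else \<zero>) \<odot>\<^bsub>M\<^esub> v i) = (\<Oplus>\<^bsub>M\<^esub>i\<in>J. \<alpha> i \<odot>\<^bsub>M\<^esub> v i)"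
proof -
  have mem: "v i \<in> carrier M" if "i \<in> I" for i using assms that by auto
  have mem': "\<alpha> i \<in> carrier R" if "i \<in> J" for i using assms that by auto
  have "(\<Oplus>\<^bsub>M\<^esub>i\<in>I. (if i \<in> J then \<alpha> i else \<zero>) \<odot>\<^bsub>M\<^esub> v i) =
    (\<Oplus>\<^bsub>M\<^esub>i\<in>J. (if i \<in> J then \<alpha> i else \<zero>) \<odot>\<^bsub>M\<^esub> v i)"
    using assms(1,2) mem mem' by (intro M.add.finprod_mono_neutral_cong_right) auto
  also have "\<dots> = (\<Oplus>\<^bsub>M\<^esub>i\<in>J. \<alpha> i \<odot>\<^bsub>M\<^esub> v i)"
    using assms(2) mem mem' by (intro M.finsum_cong') auto
  finally show ?thesis .
qed

lemma lincombs_mono: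
  assumes "finite I" "J \<subseteq> I" "v \<in> I \<rightarrow> carrier M"
  shows "lincombs v J \<subseteq> lincombs v I"
proof
  fix x assume "x \<in> lincombs v J"
  then obtain \<alpha> where a: "\<alpha> \<in> J \<rightarrow> carrier R" "x = (\<Oplus>\<^bsub>M\<^esub>i\<in>J. \<alpha> i \<odot>\<^bsub>M\<^esub> v i)"
    by (auto simp: lincombs_def)
  show "x \<in> lincombs v I"
    unfolding a(2) lincomb_extend_zero[OF assms a(1), symmetric]
    using a(1) by (intro lincombsI) auto
qed

lemma generator_in_lincombs:
  assumes "finite I" "i \<in> I" "v \<in> I \<rightarrow> carrier M"
  shows "v i \<in> lincombs v I"
proof -
  have "v i \<in> carrier M" using assms by auto
  then have "v i = (\<Oplus>\<^bsub>M\<^esub>j\<in>{i}. \<one> \<odot>\<^bsub>M\<^esub> v j)" by simp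
  also have "\<dots> \<in> lincombs v {i}" by (intro lincombsI) auto
  finally show ?thesis using lincombs_mono[of I "{i}" v] assms by auto
qed

lemma lincombs_insert:
  assumes "finite I" "i \<notin> I" "v \<in> insert i I \<rightarrow> carrier M"
  shows "lincombs v (insert i I) = {r \<odot>\<^bsub>M\<^esub> v i \<oplus>\<^bsub>M\<^esub> x | r x. r \<in> carrier R \<and> x \<in> lincombs v I}"
proof (intro equalityI subsetI)
  fix y assume "y \<in> lincombs v (insert i I)"
  then obtain \<alpha> where a: "\<alpha> \<in> insert i I \<rightarrow> carrier R" "y = (\<Oplus>\<^bsub>M\<^esub>j\<in>insert i I. \<alpha> j \<odot>\<^bsub>M\<^esub> v j)"
    by (auto simp: lincombs_def)
  have mem: "\<alpha> j \<in> carrier R" "v j \<in> carrier M" if "j \<in> insert i I" for j using a assms that by auto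
  have "y = \<alpha> i \<odot>\<^bsub>M\<^esub> v i \<oplus>\<^bsub>M\<^esub> (\<Oplus>\<^bsub>M\<^esub>j\<in>I. \<alpha> j \<odot>\<^bsub>M\<^esub> v j)"
    unfolding a(2) using assms(1,2) mem by (intro M.finsum_insert) auto
  moreover have "(\<Oplus>\<^bsub>M\<^esub>j\<in>I. \<alpha> j \<odot>\<^bsub>M\<^esub> v j) \<in> lincombs v I" using mem by (intro lincombsI) auto
  ultimately show "y \<in> {r \<odot>\<^bsub>M\<^esub> v i \<oplus>\<^bsub>M\<^esub> x | r x. r \<in> carrier R \<and> x \<in> lincombs v I}"
    using mem by blast
next
  fix y assume "y \<in> {r \<odot>\<^bsub>M\<^esub> v i \<oplus>\<^bsub>M\<^esub> x | r x. r \<in> carrier R \<and> x \<in> lincombs v I}"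
  then obtain r x where rx: "r \<in> carrier R" "x \<in> lincombs v I" "y = r \<odot>\<^bsub>M\<^esub> v i \<oplus>\<^bsub>M\<^esub> x" by blast
  have "x \<in> lincombs v (insert i I)" using rx lincombs_mono[of "insert i I" I v] assms by auto
  moreover have "v i \<in> lincombs v (insert i I)" using assms by (intro generator_in_lincombs) auto
  ultimately have "r \<odot>\<^bsub>M\<^esub> v i \<oplus>\<^bsub>M\<^esub> \<one> \<odot>\<^bsub>M\<^esub> x \<in> lincombs v (insert i I)"
    using assms rx(1) by (intro lincombs_closed) auto
  moreover have "x \<in> carrier M" using rx lincombs_carrier[of v I] assms by auto
  ultimately show "y \<in> lincombs v (insert i I)" using rx by simp
qed

lemma lincombs_insert_redundant:
  assumes "finite I" "v \<in> insert i I \<rightarrow> carrier M" "v i \<in> lincombs v I"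
  shows "lincombs v (insert i I) = lincombs v I"
proof (cases "i \<in> I")
  case True
  then show ?thesis by (simp add: insert_absorb)
next
  case False
  have "r \<odot>\<^bsub>M\<^esub> v i \<oplus>\<^bsub>M\<^esub> x \<in> lincombs v I" if "r \<in> carrier R" "x \<in> lincombs v I" for r x
  proof -
    have "r \<odot>\<^bsub>M\<^esub> v i \<oplus>\<^bsub>M\<^esub> \<one> \<odot>\<^bsub>M\<^esub> x \<in> lincombs v I"
      using assms that by (intro lincombs_closed) auto
    moreover have "x \<in> carrier M" using that lincombs_carrier[of v I] assms by auto
    ultimately show ?thesis by simp
  qed
  then have "lincombs v (insert i I) \<subseteq> lincombs v I"
    unfolding lincombs_insert[OF assms(1) False assms(2)] by auto
  moreover have "lincombs v I \<subseteq> lincombs v (insert i I)"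
    using assms by (intro lincombs_mono) auto
  ultimately show ?thesis by blast
qed

lemma modular_independentD:
  assumes "modular_independent R N M v I" "\<alpha> \<in> I \<rightarrow> carrier R"
    "(\<Oplus>\<^bsub>M\<^esub>i\<in>I. \<alpha> i \<odot>\<^bsub>M\<^esub> v i) = \<zero>\<^bsub>M\<^esub>" "i \<in> I"
  shows "\<alpha> i \<in> N"
  using assms by (simp add: modular_independent_def)

lemma modular_independent_mono:
  assumes "finite I" "J \<subseteq> I" "v \<in> I \<rightarrow> carrier M" "modular_independent R N M v I"
  shows "modular_independent R N M v J"
  unfolding modular_independent_def
proof (intro ballI impI)
  fix \<alpha> i assume a: "\<alpha> \<in> J \<rightarrow> carrier R" "(\<Oplus>\<^bsub>M\<^esub>i\<in>J. \<alpha> i \<odot>\<^bsub>M\<^esub> v i) = \<zero>\<^bsub>M\<^esub>" and i: "i \<in> J"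
  let ?b = "\<lambda>i. if i \<in> J then \<alpha> i else \<zero>"
  have "?b \<in> I \<rightarrow> carrier R" using a by auto
  moreover have "(\<Oplus>\<^bsub>M\<^esub>i\<in>I. ?b i \<odot>\<^bsub>M\<^esub> v i) = \<zero>\<^bsub>M\<^esub>"
    using lincomb_extend_zero[OF assms(1-3) a(1)] a(2) by simp
  ultimately have "?b i \<in> N"
    using assms(2) i by (intro modular_independentD[OF assms(4)]) auto
  then show "\<alpha> i \<in> N" using i by simp
qed

end

section \<open>Generating subfamilies and the bounds on the size of uniform matroids\<close>

locale chain_ring_module = local_chain_ring R \<mm> + module R M for R (structure) and \<mm> and M (structure)
begin

text \<open>A coefficient outside \<open>\<mm>\<close> is a unit, so the relation can be solved for
  its vector.\<close>

lemma dependent_imp_redundant: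
  assumes "finite I" "v \<in> I \<rightarrow> carrier M" "\<not> modular_independent R \<mm> M v I"
  obtains i where "i \<in> I" "v i \<in> lincombs v (I - {i})"
proof -
  obtain \<alpha> i where a: "\<alpha> \<in> I \<rightarrow> carrier R" "(\<Oplus>\<^bsub>M\<^esub>i\<in>I. \<alpha> i \<odot>\<^bsub>M\<^esub> v i) = \<zero>\<^bsub>M\<^esub>"
    and i: "i \<in> I" "\<alpha> i \<notin> \<mm>"
    using assms(3) by (auto simp: modular_independent_def)
  have mem: "\<alpha> j \<in> carrier R" "v j \<in> carrier M" if "j \<in> I" for j using a assms that by auto
  have u: "\<alpha> i \<in> Units R" using i mem nonunit_in_maxideal by blast
  let ?S = "\<Oplus>\<^bsub>M\<^esub>j\<in>I - {i}. \<alpha> j \<odot>\<^bsub>M\<^esub> v j"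
  have S: "?S \<in> lincombs v (I - {i})" using mem by (intro lincombsI) auto
  then have Sc: "?S \<in> carrier M" using lincombs_carrier[of v "I - {i}"] mem by auto
  have "(\<Oplus>\<^bsub>M\<^esub>j\<in>insert i (I - {i}). \<alpha> j \<odot>\<^bsub>M\<^esub> v j) = \<alpha> i \<odot>\<^bsub>M\<^esub> v i \<oplus>\<^bsub>M\<^esub> ?S"
    using assms(1) mem i by (intro M.finsum_insert) auto
  then have z: "\<alpha> i \<odot>\<^bsub>M\<^esub> v i \<oplus>\<^bsub>M\<^esub> ?S = \<zero>\<^bsub>M\<^esub>"
    using a(2) i by (simp add: insert_absorb)
  have "\<alpha> i \<odot>\<^bsub>M\<^esub> v i = \<ominus>\<^bsub>M\<^esub> ?S"
    using z Sc mem i by (intro M.minus_equality[symmetric]) auto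
  then have "inv (\<alpha> i) \<odot>\<^bsub>M\<^esub> (\<alpha> i \<odot>\<^bsub>M\<^esub> v i) = (\<ominus> (inv (\<alpha> i))) \<odot>\<^bsub>M\<^esub> ?S"
    using u Sc by (simp add: smult_r_minus smult_l_minus)
  moreover have "inv (\<alpha> i) \<odot>\<^bsub>M\<^esub> (\<alpha> i \<odot>\<^bsub>M\<^esub> v i) = v i"
    using u mem i by (simp add: smult_assoc1[symmetric] Units_l_inv)
  \<comment> \<open>The zero summand only supplies the two-term form that
    \<open>lincombs_closed\<close> expects.\<close>
  ultimately have "v i = (\<ominus> (inv (\<alpha> i))) \<odot>\<^bsub>M\<^esub> ?S \<oplus>\<^bsub>M\<^esub> \<zero> \<odot>\<^bsub>M\<^esub> ?S"
    using u Sc by simp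
  also have "\<dots> \<in> lincombs v (I - {i})"
    using S u assms(1) mem by (intro lincombs_closed) auto
  finally show ?thesis using i(1) that by blast
qed

text \<open>A generating subset of least size has no redundant vector. Starting from a maximal
  independent subset would not do: over the integers modulo 4, the vector 2 is modular independent,
  and \<open>{2}\<close> is maximal so in \<open>{1, 2}\<close>, but it does not generate 1.\<close>

lemma independent_generating_subset:
  assumes "finite E" "v \<in> E \<rightarrow> carrier M"
  obtains J where "J \<subseteq> E" "modular_independent R \<mm> M v J" "\<And>i. i \<in> E \<Longrightarrow> v i \<in> lincombs v J"
proof -
  define P where "P J \<longleftrightarrow> J \<subseteq> E \<and> lincombs v J = lincombs v E" for J
  have "P E" by (simp add: P_def)
  then obtain J where J: "P J" and min: "\<And>K. P K \<Longrightarrow> card J \<le> card K"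
    by (metis ex_has_least_nat)
  have JE: "J \<subseteq> E" and fin: "finite J" using J assms(1) finite_subset by (auto simp: P_def)
  have "modular_independent R \<mm> M v J"
  proof (rule ccontr)
    assume "\<not> modular_independent R \<mm> M v J"
    then obtain i where i: "i \<in> J" "v i \<in> lincombs v (J - {i})"
      using dependent_imp_redundant[of J v] JE fin assms(2) by blast
    have "lincombs v (insert i (J - {i})) = lincombs v (J - {i})"
      using i JE fin assms(2) by (intro lincombs_insert_redundant) auto
    then have "P (J - {i})" using J i(1) by (auto simp: P_def insert_absorb)
    then have "card J \<le> card (J - {i})" by (rule min)
    then show False using fin i(1) by (metis card_Diff1_less not_le)
  qed
  moreover have "v i \<in> lincombs v J" if "i \<in> E" for i
    using generator_in_lincombs[OF assms(1) that assms(2)] J by (simp add: P_def)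
  ultimately show ?thesis using that JE by blast
qed

text \<open>Pads an independent generating set to size exactly \<open>k\<close>; a larger subfamily
  still generates.\<close>

lemma independent_generating_extension:
  assumes "finite E" "v \<in> E \<rightarrow> carrier M" "k \<le> card E"
    and indep: "\<And>I. I \<subseteq> E \<Longrightarrow> modular_independent R \<mm> M v I \<Longrightarrow> card I \<le> k"
  obtains J where "J \<subseteq> E" "card J = k" "\<And>i. i \<in> E \<Longrightarrow> v i \<in> lincombs v J"
proof -
  obtain J where J: "J \<subseteq> E" "modular_independent R \<mm> M v J" "\<And>i. i \<in> E \<Longrightarrow> v i \<in> lincombs v J"
    using independent_generating_subset[OF assms(1,2)] by blast
  then obtain K where K: "J \<subseteq> K" "K \<subseteq> E" "card K = k"
    using exists_subset_between[of J k E] indep assms(1,3) by blast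
  have "finite K" using K assms(1) finite_subset by blast
  then have "lincombs v J \<subseteq> lincombs v K"
    using K assms(2) by (intro lincombs_mono) auto
  then show ?thesis using K J that by blast
qed

lemma multiple_imp_dependent:
  assumes "i \<noteq> j" "v i \<in> carrier M" "v j \<in> carrier M" "r \<in> carrier R" "v i = r \<odot>\<^bsub>M\<^esub> v j"
  shows "\<not> modular_independent R \<mm> M v {i, j}"
proof
  assume indep: "modular_independent R \<mm> M v {i, j}"
  define \<alpha> where "\<alpha> = (\<lambda>k. if k = i then \<one> else \<ominus> r)"
  have "(\<Oplus>\<^bsub>M\<^esub>k\<in>{i, j}. \<alpha> k \<odot>\<^bsub>M\<^esub> v k) = v i \<oplus>\<^bsub>M\<^esub> (\<ominus> r) \<odot>\<^bsub>M\<^esub> v j"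
    using assms by (simp add: \<alpha>_def)
  also have "\<dots> = \<zero>\<^bsub>M\<^esub>"
    using assms(3-5) by (simp add: smult_l_minus M.r_neg)
  finally have "\<alpha> i \<in> \<mm>"
    using indep assms(4) by (auto simp: modular_independent_def \<alpha>_def)
  then show False using one_notin_maxideal by (simp add: \<alpha>_def)
qed

lemma uniform_rank_2_bound:
  assumes fin: "finite (carrier R)" and E: "finite E" "v \<in> E \<rightarrow> carrier M"
    and unif: "\<And>I. I \<subseteq> E \<Longrightarrow> modular_independent R \<mm> M v I \<longleftrightarrow> card I \<le> 2"
  shows "card E \<le> card (carrier R) + card \<mm>"
proof (rule ccontr)
  assume "\<not> ?thesis"
  then have big: "card (carrier R) + card \<mm> < card E" by simp
  \<comment> \<open>\<open>carrier R\<close> and \<open>\<mm>\<close> each contribute at least one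
    element.\<close>
  then have "2 \<le> card E" using card_carrier_maxideal_pos[OF fin] by linarith
  then obtain J where J: "J \<subseteq> E" "card J = 2" "\<And>i. i \<in> E \<Longrightarrow> v i \<in> lincombs v J"
    using independent_generating_extension[OF E, of 2] unif by blast
  then obtain a b where ab: "J = {a, b}" "a \<noteq> b" by (auto simp: card_2_iff)
  have vc: "v a \<in> carrier M" "v b \<in> carrier M" using ab J E by auto
  have "\<forall>i\<in>E. \<exists>\<alpha>. \<alpha> \<in> J \<rightarrow> carrier R \<and> v i = (\<Oplus>\<^bsub>M\<^esub>j\<in>J. \<alpha> j \<odot>\<^bsub>M\<^esub> v j)"
    using J(3) by (auto simp: lincombs_def)
  then obtain \<alpha> where \<alpha>: "\<forall>i\<in>E. \<alpha> i \<in> J \<rightarrow> carrier R \<and> v i = (\<Oplus>\<^bsub>M\<^esub>j\<in>J. \<alpha> i j \<odot>\<^bsub>M\<^esub> v j)"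
    by (rule bchoice[THEN exE])
  \<comment> \<open>Coordinates with respect to the generators \<open>v a\<close> and
    \<open>v b\<close>. They need not be unique, so one choice is fixed.\<close>
  define x y where "x i = \<alpha> i a" and "y i = \<alpha> i b" for i
  have xy: "x \<in> E \<rightarrow> carrier R" "y \<in> E \<rightarrow> carrier R"
    using \<alpha> ab(1) by (auto simp: x_def y_def)
  have v_xy: "v i = x i \<odot>\<^bsub>M\<^esub> v a \<oplus>\<^bsub>M\<^esub> y i \<odot>\<^bsub>M\<^esub> v b" if i: "i \<in> E" for i
  proof -
    have "v i = (\<Oplus>\<^bsub>M\<^esub>j\<in>{a, b}. \<alpha> i j \<odot>\<^bsub>M\<^esub> v j)" using \<alpha> i ab(1) by blast
    also have "\<dots> = \<alpha> i a \<odot>\<^bsub>M\<^esub> v a \<oplus>\<^bsub>M\<^esub> \<alpha> i b \<odot>\<^bsub>M\<^esub> v b"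
      using xy i vc ab(2) by (simp add: x_def y_def Pi_iff)
    finally show ?thesis by (simp add: x_def y_def)
  qed
  obtain i j p q r s where ij: "i \<in> E" "j \<in> E" "i \<noteq> j" "(p, q) \<in> proj_line"
    and rs: "r \<in> carrier R" "s \<in> carrier R"
    "x i = r \<otimes> p" "y i = r \<otimes> q" "x j = s \<otimes> p" "y j = s \<otimes> q"
    by (rule proj_line_pigeonhole[OF fin big xy])
  note pq = proj_line_closed[OF ij(4)]
  let ?u = "p \<odot>\<^bsub>M\<^esub> v a \<oplus>\<^bsub>M\<^esub> q \<odot>\<^bsub>M\<^esub> v b"
  have u: "?u \<in> carrier M" using pq vc by simp
  have vi: "v i = r \<odot>\<^bsub>M\<^esub> ?u" and vj: "v j = s \<odot>\<^bsub>M\<^esub> ?u"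
    using v_xy[OF ij(1)] v_xy[OF ij(2)] rs pq(1,2) vc by (simp_all add: smult_assoc1 smult_r_distr)
  have dep: "\<not> modular_independent R \<mm> M v {k, l}"
    if "k \<noteq> l" "k \<in> E" "l \<in> E" "t \<in> carrier R" "v k = t \<odot>\<^bsub>M\<^esub> v l" for k l t
    using that E by (intro multiple_imp_dependent) auto
  have ind: "modular_independent R \<mm> M v {i, j}" "modular_independent R \<mm> M v {j, i}"
    using unif[of "{i, j}"] ij by (auto simp: insert_commute)
  \<comment> \<open>Both vectors are multiples of \<open>?u\<close>, and one of the scalars
    \<open>r\<close>, \<open>s\<close> divides the other. So one vector is a multiple of the other,
    against independence of the pair.\<close>
  from dvd_linear[OF rs(1,2)] show False
  proof (elim disjE bexE)
    fix t assume "t \<in> carrier R" "r = t \<otimes> s"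
    then show False using dep[of i j t] vi vj u rs ij ind by (simp add: smult_assoc1)
  next
    fix t assume "t \<in> carrier R" "s = t \<otimes> r"
    then show False using dep[of j i t] vi vj u rs ij ind by (simp add: smult_assoc1)
  qed
qed

text \<open>Relations replace duality: the columns \<open>(f i, g i)\<close> of two relations play
  the part that the coordinate pairs play in rank 2.\<close>

lemma uniform_corank_2_bound:
  assumes fin: "finite (carrier R)" and E: "finite E" "v \<in> E \<rightarrow> carrier M" "card E = k + 2"
    and unif: "\<And>I. I \<subseteq> E \<Longrightarrow> modular_independent R \<mm> M v I \<longleftrightarrow> card I \<le> k"
  shows "card E \<le> card (carrier R) + card \<mm>"
proof (rule ccontr)
  assume "\<not> ?thesis"
  then have big: "card (carrier R) + card \<mm> < card E" by simp
  have "k \<le> card E" using E(3) by simp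
  then obtain J where J: "J \<subseteq> E" "card J = k" "\<And>i. i \<in> E \<Longrightarrow> v i \<in> lincombs v J"
    using independent_generating_extension[OF E(1,2), of k] unif by blast
  have finJ: "finite J" using J E(1) finite_subset by blast
  have "card (E - J) = 2" using J E finJ by (simp add: card_Diff_subset)
  then obtain p q where pq: "E - J = {p, q}" "p \<noteq> q" by (auto simp: card_2_iff)
  then have pqE: "p \<in> E" "p \<notin> J" "q \<in> E" "q \<notin> J" by auto
  have vc: "v i \<in> carrier M" if "i \<in> E" for i using E that by auto
  \<comment> \<open>Expressing \<open>v e\<close> through \<open>J\<close> gives a relation that is
    one at \<open>e\<close> and zero at the other index outside \<open>J\<close>. Hence
    \<open>f\<close> and \<open>g\<close> restrict to the identity matrix on \<open>p\<close>,
    \<open>q\<close>.\<close>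
  have relation: "\<exists>\<gamma>. \<gamma> \<in> E \<rightarrow> carrier R \<and> \<gamma> e = \<one> \<and> (\<forall>i\<in>E - J - {e}. \<gamma> i = \<zero>) \<and>
      (\<Oplus>\<^bsub>M\<^esub>i\<in>E. \<gamma> i \<odot>\<^bsub>M\<^esub> v i) = \<zero>\<^bsub>M\<^esub>" if e: "e \<in> E - J" for e
  proof -
    obtain \<alpha> where a: "\<alpha> \<in> J \<rightarrow> carrier R" "v e = (\<Oplus>\<^bsub>M\<^esub>j\<in>J. \<alpha> j \<odot>\<^bsub>M\<^esub> v j)"
      using J(3) e by (auto simp: lincombs_def)
    define \<beta> where "\<beta> = (\<lambda>i. if i \<in> J then \<alpha> i else \<zero>)"
    define \<delta> where "\<delta> = (\<lambda>i. if i \<in> {e} then \<one> else \<zero>)"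
    have bc: "\<beta> \<in> E \<rightarrow> carrier R" "\<delta> \<in> E \<rightarrow> carrier R" using a by (auto simp: \<beta>_def \<delta>_def)
    have "(\<Oplus>\<^bsub>M\<^esub>i\<in>E. \<beta> i \<odot>\<^bsub>M\<^esub> v i) = v e"
      unfolding \<beta>_def a(2) using E J a by (intro lincomb_extend_zero) auto
    moreover have "(\<Oplus>\<^bsub>M\<^esub>i\<in>E. \<delta> i \<odot>\<^bsub>M\<^esub> v i) = v e"
      unfolding \<delta>_def using E e vc by (subst lincomb_extend_zero) auto
    ultimately have "(\<Oplus>\<^bsub>M\<^esub>i\<in>E. (\<one> \<otimes> \<delta> i \<oplus> (\<ominus> \<one>) \<otimes> \<beta> i) \<odot>\<^bsub>M\<^esub> v i) = \<zero>\<^bsub>M\<^esub>"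
      using lincomb_lincomb[OF E(1,2) bc(2,1), of \<one> "\<ominus> \<one>"] e vc
      by (simp add: smult_l_minus M.r_neg)
    then show ?thesis
      using e funcset_mem[OF a(1)]
      by (intro exI[of _ "\<lambda>i. \<one> \<otimes> \<delta> i \<oplus> (\<ominus> \<one>) \<otimes> \<beta> i"]) (auto simp: \<beta>_def \<delta>_def)
  qed
  obtain f where f: "f \<in> E \<rightarrow> carrier R" "f p = \<one>" "f q = \<zero>"
    "(\<Oplus>\<^bsub>M\<^esub>i\<in>E. f i \<odot>\<^bsub>M\<^esub> v i) = \<zero>\<^bsub>M\<^esub>"
    using relation[of p] pq by auto
  obtain g where g: "g \<in> E \<rightarrow> carrier R" "g q = \<one>" "g p = \<zero>"
    "(\<Oplus>\<^bsub>M\<^esub>i\<in>E. g i \<odot>\<^bsub>M\<^esub> v i) = \<zero>\<^bsub>M\<^esub>"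
    using relation[of q] pq by auto
  obtain i j x y r s where ij: "i \<in> E" "j \<in> E" "i \<noteq> j" and xy: "(x, y) \<in> proj_line"
    and rs: "r \<in> carrier R" "s \<in> carrier R"
      "f i = r \<otimes> x" "g i = r \<otimes> y" "f j = s \<otimes> x" "g j = s \<otimes> y"
    by (rule proj_line_pigeonhole[OF fin big f(1) g(1)])
  note xyc = proj_line_closed[OF xy]
  \<comment> \<open>The combination of the relations \<open>f\<close> and \<open>g\<close> orthogonal to \<open>(x, y)\<close> vanishes at \<open>i\<close> and \<open>j\<close>.\<close>
  define h where "h = (\<lambda>k. y \<otimes> f k \<oplus> (\<ominus> x) \<otimes> g k)"
  have hc: "h \<in> E \<rightarrow> carrier R" using f g xyc by (auto simp: h_def)
  have hij: "h i = \<zero>" "h j = \<zero>"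
    unfolding h_def rs using rs(1,2) xyc(1,2) by algebra+
  let ?I = "E - {i, j}"
  have "(\<Oplus>\<^bsub>M\<^esub>k\<in>E. h k \<odot>\<^bsub>M\<^esub> v k) = \<zero>\<^bsub>M\<^esub>"
    using lincomb_lincomb[OF E(1,2) f(1) g(1), of y "\<ominus> x"] f(4) g(4) xyc(1,2)
    by (simp add: h_def)
  moreover have "(\<Oplus>\<^bsub>M\<^esub>k\<in>E. h k \<odot>\<^bsub>M\<^esub> v k) = (\<Oplus>\<^bsub>M\<^esub>k\<in>?I. h k \<odot>\<^bsub>M\<^esub> v k)"
    using hij vc hc E(1) by (intro M.add.finprod_mono_neutral_cong_right) auto
  \<comment> \<open>Removing two of the \<open>k + 2\<close> indices leaves exactly
    \<open>k\<close>.\<close>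
  moreover have "modular_independent R \<mm> M v ?I"
    using unif[of ?I] ij E by (simp add: card_Diff_subset)
  moreover have "h \<in> ?I \<rightarrow> carrier R" using hc by auto
  ultimately have "h k \<in> \<mm>" if "k \<in> ?I" for k
    using that by (intro modular_independentD[of \<mm> v ?I h]) auto
  then have "h k \<in> \<mm>" if "k \<in> E" for k
    using that hij max.zero_closed by (cases "k \<in> ?I") auto
  then have "h p \<in> \<mm>" "h q \<in> \<mm>" using pqE by auto
  \<comment> \<open>The normalisation at \<open>p\<close> and \<open>q\<close> recovers the
    coordinates of the point from \<open>h\<close>. Both would lie in \<open>\<mm>\<close>, yet one
    of them is one.\<close>
  moreover have "h p = y" "h q = \<ominus> x" using f g xyc(1,2) by (auto simp: h_def)
  ultimately have "y \<in> \<mm>" "x \<in> \<mm>"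
    using max.a_inv_closed[of "\<ominus> x"] xyc by auto
  then show False using xyc(3) one_notin_maxideal by auto
qed

end

section \<open>The projective line represents a uniform matroid\<close>

text \<open>The module \<open>R \<times> R\<close>, carried to the type of the codomain of an injection \<open>g\<close>. The fields
  \<^const>\<open>monoid.mult\<close> and \<^const>\<open>one\<close> of the record play no role in a module.\<close>

definition pair_module :: "('r, 'm) ring_scheme \<Rightarrow> ('r \<times> 'r \<Rightarrow> 'v) \<Rightarrow> ('r, 'v) module" where
  "pair_module R g =
    (let h = the_inv_into (carrier R \<times> carrier R) g in
     \<lparr>carrier = g ` (carrier R \<times> carrier R), monoid.mult = undefined, one = undefined,
      ring.zero = g (\<zero>\<^bsub>R\<^esub>, \<zero>\<^bsub>R\<^esub>),
      ring.add = (\<lambda>x y. g (fst (h x) \<oplus>\<^bsub>R\<^esub> fst (h y), snd (h x) \<oplus>\<^bsub>R\<^esub> snd (h y))),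
      module.smult = (\<lambda>r x. g (r \<otimes>\<^bsub>R\<^esub> fst (h x), r \<otimes>\<^bsub>R\<^esub> snd (h x)))\<rparr>)"

context cring
begin

context
  fixes g :: "'a \<times> 'a \<Rightarrow> 'v"
  assumes inj: "inj_on g (carrier R \<times> carrier R)"
begin

lemma pair_module_simps:
  "carrier (pair_module R g) = g ` (carrier R \<times> carrier R)"
  "\<zero>\<^bsub>pair_module R g\<^esub> = g (\<zero>, \<zero>)"
  "\<lbrakk>a \<in> carrier R; b \<in> carrier R; c \<in> carrier R; d \<in> carrier R\<rbrakk> \<Longrightarrow>
    g (a, b) \<oplus>\<^bsub>pair_module R g\<^esub> g (c, d) = g (a \<oplus> c, b \<oplus> d)"
  "\<lbrakk>a \<in> carrier R; b \<in> carrier R\<rbrakk> \<Longrightarrow> r \<odot>\<^bsub>pair_module R g\<^esub> g (a, b) = g (r \<otimes> a, r \<otimes> b)"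
  using the_inv_into_f_f[OF inj] by (simp_all add: pair_module_def Let_def)

lemma module_pair_module: "module R (pair_module R g)"
proof (rule moduleI)
  show "cring R" by (rule cring_axioms)
  show "abelian_group (pair_module R g)"
  proof (rule abelian_groupI)
    fix x assume "x \<in> carrier (pair_module R g)"
    then obtain a b where ab: "a \<in> carrier R" "b \<in> carrier R" "x = g (a, b)"
      by (auto simp: pair_module_simps)
    then show "\<exists>y\<in>carrier (pair_module R g). y \<oplus>\<^bsub>pair_module R g\<^esub> x = \<zero>\<^bsub>pair_module R g\<^esub>"
      by (intro bexI[of _ "g (\<ominus> a, \<ominus> b)"]) (auto simp: pair_module_simps l_neg)
  qed (auto simp: pair_module_simps a_ac)
qed (auto simp: pair_module_simps l_distr r_distr m_assoc)

lemma pair_module_eq_zero: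
  assumes "a \<in> carrier R" "b \<in> carrier R"
  shows "g (a, b) = \<zero>\<^bsub>pair_module R g\<^esub> \<longleftrightarrow> a = \<zero> \<and> b = \<zero>"
  using inj_on_eq_iff[OF inj, of "(a, b)" "(\<zero>, \<zero>)"] assms by (simp add: pair_module_simps)

end

end

context local_chain_ring
begin

text \<open>Three points satisfy a relation with a coefficient one, whereas a relation between two
  distinct points has its coefficients in \<open>\<mm>\<close>. Other sizes follow by
  heredity.\<close>

lemma proj_line_independent_iff:
  fixes g :: "'a \<times> 'a \<Rightarrow> 'v"
  assumes inj: "inj_on g (carrier R \<times> carrier R)" and fin: "finite E" and "2 \<le> card E"
    and P: "P \<in> E \<rightarrow> proj_line" "inj_on P E" and IE: "I \<subseteq> E"
  shows "modular_independent R \<mm> (pair_module R g) (\<lambda>i. g (P i)) I \<longleftrightarrow> card I \<le> 2"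
proof -
  let ?V = "pair_module R g" and ?v = "\<lambda>i. g (P i)"
  interpret V: module R ?V by (rule module_pair_module[OF inj])
  note simps = pair_module_simps(3)[OF inj] pair_module_eq_zero[OF inj]
  have Pc: "fst (P i) \<in> carrier R" "snd (P i) \<in> carrier R" if "i \<in> E" for i
    using proj_line_closed(1,2)[of "fst (P i)" "snd (P i)"] funcset_mem[OF P(1) that] by auto
  have smult: "r \<odot>\<^bsub>?V\<^esub> ?v i = g (r \<otimes> fst (P i), r \<otimes> snd (P i))"
    if "i \<in> E" "r \<in> carrier R" for r i
    using pair_module_simps(4)[OF inj Pc[OF that(1)], of r] by simp
  have vc: "?v i \<in> carrier ?V" if "i \<in> E" for i
    unfolding pair_module_simps(1)[OF inj] using Pc[OF that] by (simp add: mem_Times_iff)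
  have finI: "finite I" using IE fin finite_subset by blast
  show ?thesis
  proof
    assume indep: "modular_independent R \<mm> ?V ?v I"
    show "card I \<le> 2"
    proof (rule ccontr)
      assume "\<not> card I \<le> 2"
      then obtain K where K: "K \<subseteq> I" "card K = 3"
        using obtain_subset_with_card_n[of 3 I] by auto
      then obtain i j k where ijk: "K = {i, j, k}" "i \<noteq> j" "i \<noteq> k" "j \<noteq> k"
        by (auto simp: card_3_iff)
      then have E: "i \<in> E" "j \<in> E" "k \<in> E" using K IE by auto
      have "(fst (P i), snd (P i)) \<in> proj_line" using P E by auto
      then obtain a b c where abc: "a \<in> carrier R" "b \<in> carrier R" "c \<in> carrier R" "b = \<one> \<or> c = \<one>"
        "a \<otimes> fst (P i) \<oplus> (b \<otimes> fst (P j) \<oplus> c \<otimes> fst (P k)) = \<zero>"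
        "a \<otimes> snd (P i) \<oplus> (b \<otimes> snd (P j) \<oplus> c \<otimes> snd (P k)) = \<zero>"
        using proj_line_triple_relation[OF _ Pc[OF E(2)] Pc[OF E(3)]] by metis
      define \<alpha> where "\<alpha> = (\<lambda>l. if l = i then a else if l = j then b else c)"
      have "(\<Oplus>\<^bsub>?V\<^esub>l\<in>K. \<alpha> l \<odot>\<^bsub>?V\<^esub> ?v l) = a \<odot>\<^bsub>?V\<^esub> ?v i \<oplus>\<^bsub>?V\<^esub> (b \<odot>\<^bsub>?V\<^esub> ?v j \<oplus>\<^bsub>?V\<^esub> c \<odot>\<^bsub>?V\<^esub> ?v k)"
        unfolding ijk(1) using ijk(2-) abc(1-3) vc E by (simp add: \<alpha>_def)
      also have "\<dots> = \<zero>\<^bsub>?V\<^esub>"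
        using abc Pc E by (simp add: smult simps)
      finally have z: "(\<Oplus>\<^bsub>?V\<^esub>l\<in>K. \<alpha> l \<odot>\<^bsub>?V\<^esub> ?v l) = \<zero>\<^bsub>?V\<^esub>" .
      have ac: "\<alpha> \<in> K \<rightarrow> carrier R" using abc by (auto simp: \<alpha>_def)
      have "modular_independent R \<mm> ?V ?v K"
        using indep K(1) finI vc IE by (intro V.modular_independent_mono[of I K]) auto
      then have "\<alpha> j \<in> \<mm>" "\<alpha> k \<in> \<mm>"
        using V.modular_independentD[OF _ ac z] ijk(1) by auto
      \<comment> \<open>These are the coefficients \<open>b\<close> and \<open>c\<close>, one of
        which is one.\<close>
      then show False using abc(4) ijk one_notin_maxideal by (auto simp: \<alpha>_def)
    qed
  next
    assume "card I \<le> 2"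
    \<comment> \<open>Only pairs need a computation: smaller sets are enlarged to a pair, which the
      assumption on \<open>card E\<close> permits.\<close>
    then obtain K where K: "I \<subseteq> K" "K \<subseteq> E" "card K = 2"
      using exists_subset_between[of I 2 E] assms(3) IE fin by blast
    then obtain i j where ij: "K = {i, j}" "i \<noteq> j" by (auto simp: card_2_iff)
    then have E: "i \<in> E" "j \<in> E" using K by auto
    have "modular_independent R \<mm> ?V ?v K"
      unfolding modular_independent_def
    proof (intro ballI impI)
      fix \<alpha> l assume ac: "\<alpha> \<in> K \<rightarrow> carrier R" and z: "(\<Oplus>\<^bsub>?V\<^esub>l\<in>K. \<alpha> l \<odot>\<^bsub>?V\<^esub> ?v l) = \<zero>\<^bsub>?V\<^esub>"
        and l: "l \<in> K"
      have ij_c: "\<alpha> i \<in> carrier R" "\<alpha> j \<in> carrier R" using ac ij by auto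
      have "\<alpha> i \<odot>\<^bsub>?V\<^esub> ?v i \<oplus>\<^bsub>?V\<^esub> \<alpha> j \<odot>\<^bsub>?V\<^esub> ?v j = \<zero>\<^bsub>?V\<^esub>"
        using z ij ij_c vc E by simp
      then have eq: "\<alpha> i \<otimes> fst (P i) \<oplus> \<alpha> j \<otimes> fst (P j) = \<zero>" "\<alpha> i \<otimes> snd (P i) \<oplus> \<alpha> j \<otimes> snd (P j) = \<zero>"
        using ij_c Pc E by (auto simp: smult simps)
      have "P i \<noteq> P j" using P(2) ij E by (auto simp: inj_on_def)
      then have "(fst (P i), snd (P i)) \<noteq> (fst (P j), snd (P j))" by simp
      moreover have "(fst (P i), snd (P i)) \<in> proj_line" "(fst (P j), snd (P j)) \<in> proj_line"
        using P(1) E by auto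
      ultimately have "\<alpha> i \<in> \<mm>" "\<alpha> j \<in> \<mm>"
        using proj_line_pair_relation ij_c eq by blast+
      then show "\<alpha> l \<in> \<mm>" using l ij by auto
    qed
    moreover have "?v \<in> K \<rightarrow> carrier ?V" using vc K by auto
    ultimately show "modular_independent R \<mm> ?V ?v I"
      using K fin finite_subset by (intro V.modular_independent_mono[of K I]) auto
  qed
qed

end

section \<open>Representations of uniform matroids\<close>

text \<open>Independence in a uniform matroid depends on cardinality alone, which bijections
  preserve, so the isomorphism can be eliminated.\<close>

lemma representable_uniform_iff:
  "representable_over TYPE('v) R N (uniform_matroid k n) \<longleftrightarrow>
    (\<exists>(E :: nat set) (V :: ('r, 'v) module) A. finite E \<and> card E = n \<and> module R V \<and>
      A \<in> E \<rightarrow> carrier V \<and> (\<forall>I\<subseteq>E. modular_independent R N V A I \<longleftrightarrow> card I \<le> k))"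
  (is "?L \<longleftrightarrow> ?R")
proof
  assume ?L
  then obtain E V A where E': "finite (E :: nat set)" "card E = card (ground (uniform_matroid k n))"
      "module R (V :: ('r, 'v) module)" "A \<in> E \<rightarrow> carrier V"
    and iso: "isomorphic_systems (uniform_matroid k n) (vector_system R N V A E)"
    unfolding representable_over_def by blast
  then have E: "finite E" "card E = n" "module R V" "A \<in> E \<rightarrow> carrier V"
    by (simp_all add: uniform_matroid_def)
  obtain \<phi> where "bij_betw \<phi> (ground (uniform_matroid k n)) (ground (vector_system R N V A E))"
    and "\<forall>I\<subseteq>ground (uniform_matroid k n).
      I \<in> indeps (uniform_matroid k n) \<longleftrightarrow> \<phi> ` I \<in> indeps (vector_system R N V A E)"
    using iso unfolding isomorphic_systems_def by blast
  then have \<phi>: "bij_betw \<phi> {..<n} E"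
      "\<forall>I\<subseteq>{..<n}. I \<in> indeps (uniform_matroid k n) \<longleftrightarrow> \<phi> ` I \<in> indeps (vector_system R N V A E)"
    by (simp_all add: uniform_matroid_def vector_system_def)
  have "modular_independent R N V A I \<longleftrightarrow> card I \<le> k" if I: "I \<subseteq> E" for I
  proof -
    obtain K where K: "K \<subseteq> {..<n}" "I = \<phi> ` K"
      using I \<phi>(1) by (metis bij_betw_imp_surj_on subset_imageE)
    have "card I = card K"
      unfolding K(2) by (rule card_image[OF inj_on_subset[OF bij_betw_imp_inj_on[OF \<phi>(1)] K(1)]])
    then show ?thesis
      using \<phi>(2) K I by (auto simp: uniform_matroid_def vector_system_def)
  qed
  then show ?R using E by (intro exI[of _ E] exI[of _ V] exI[of _ A]) simp
next
  assume ?R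
  then obtain E V A where E: "finite (E :: nat set)" "card E = n" "module R (V :: ('r, 'v) module)" "A \<in> E \<rightarrow> carrier V"
    and I: "\<forall>I\<subseteq>E. modular_independent R N V A I \<longleftrightarrow> card I \<le> k" by blast
  obtain \<phi> where \<phi>: "bij_betw \<phi> {..<n} E"
    using ex_bij_betw_nat_finite[OF E(1)] E(2) by (auto simp: atLeast0LessThan)
  have "I \<in> indeps (uniform_matroid k n) \<longleftrightarrow> \<phi> ` I \<in> indeps (vector_system R N V A E)"
    if K: "I \<subseteq> {..<n}" for I
  proof -
    have "card (\<phi> ` I) = card I"
      by (rule card_image[OF inj_on_subset[OF bij_betw_imp_inj_on[OF \<phi>] K]])
    moreover have "\<phi> ` I \<subseteq> E" using \<phi> K by (auto simp: bij_betw_def)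
    ultimately show ?thesis using I K by (simp add: uniform_matroid_def vector_system_def)
  qed
  then have "isomorphic_systems (uniform_matroid k n) (vector_system R N V A E)"
    unfolding isomorphic_systems_def using \<phi>
    by (intro exI[of _ \<phi>]) (auto simp: uniform_matroid_def vector_system_def)
  then show ?L
    unfolding representable_over_def using E
    by (intro exI[of _ E] exI[of _ V] exI[of _ A]) (auto simp: uniform_matroid_def)
qed

section \<open>Representability in rank 2 and corank 2\<close>

context local_chain_ring
begin

lemma representable_uniform_rank_2_iff:
  assumes fin: "finite (carrier R)" and inf: "infinite (UNIV :: 'v set)"
  shows "representable_over TYPE('v) R \<mm> (uniform_matroid 2 n) \<longleftrightarrow> n \<le> card (carrier R) + card \<mm>"
proof
  assume "representable_over TYPE('v) R \<mm> (uniform_matroid 2 n)"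
  then obtain E V v where E: "finite (E :: nat set)" "card E = n" "module R (V :: ('a, 'v) module)"
      "v \<in> E \<rightarrow> carrier V" "\<forall>I\<subseteq>E. modular_independent R \<mm> V v I \<longleftrightarrow> card I \<le> 2"
    unfolding representable_uniform_iff by blast
  interpret chain_ring_module R \<mm> V
    using E(3) by (simp add: chain_ring_module_def local_chain_ring_axioms)
  show "n \<le> card (carrier R) + card \<mm>"
    using uniform_rank_2_bound[OF fin E(1,4)] E(2,5) by blast
next
  assume n: "n \<le> card (carrier R) + card \<mm>"
  let ?N = "card (carrier R) + card \<mm>"
  \<comment> \<open>An infinite type contains a set of the finite size of
    \<open>carrier R \<times> carrier R\<close>, which makes room for a copy of the module of
    pairs.\<close>
  obtain g :: "'a \<times> 'a \<Rightarrow> 'v" where g: "inj_on g (carrier R \<times> carrier R)"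
  proof -
    obtain S :: "'v set" where "finite S" "card S = card (carrier R \<times> carrier R)"
      using infinite_arbitrarily_large[OF inf] by blast
    then show ?thesis
      using that finite_same_card_bij[of "carrier R \<times> carrier R" S] fin by (auto simp: bij_betw_def)
  qed
  obtain P where P: "bij_betw P {..<?N} proj_line"
    using ex_bij_betw_nat_finite[OF card_proj_line(1)[OF fin]] card_proj_line(2)[OF fin]
    by (auto simp: atLeast0LessThan)
  have Pi: "P \<in> {..<?N} \<rightarrow> proj_line" and inj: "inj_on P {..<?N}"
    using P by (auto simp: bij_betw_def)
  \<comment> \<open>Independence is settled for all \<open>?N\<close> points and then restricted to
    \<open>{..<n}\<close>, because for \<open>n < 2\<close> the lower bound would fail.\<close>
  have "2 \<le> card {..<?N}" using card_carrier_maxideal_pos[OF fin] by simp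
  note ind = proj_line_independent_iff[OF g finite_lessThan this Pi inj]
  have "(\<lambda>i. g (P i)) \<in> {..<n} \<rightarrow> carrier (pair_module R g)"
  proof
    fix i assume "i \<in> {..<n}"
    then have "P i \<in> proj_line" using Pi n by auto
    then have "P i \<in> carrier R \<times> carrier R"
      using maxideal_subset by (auto simp: proj_line_def)
    then show "g (P i) \<in> carrier (pair_module R g)" by (simp add: pair_module_simps[OF g])
  qed
  moreover have "\<forall>I\<subseteq>{..<n}. modular_independent R \<mm> (pair_module R g) (\<lambda>i. g (P i)) I \<longleftrightarrow> card I \<le> 2"
    using ind n by (meson lessThan_subset_iff order_trans)
  ultimately show "representable_over TYPE('v) R \<mm> (uniform_matroid 2 n)"
    unfolding representable_uniform_iff using module_pair_module[OF g]
    by (intro exI[of _ "{..<n}"] exI[of _ "pair_module R g"] exI[of _ "\<lambda>i. g (P i)"]) auto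
qed

lemma not_representable_uniform_corank_2:
  assumes fin: "finite (carrier R)" and "card (carrier R) + card \<mm> < k + 2"
  shows "\<not> representable_over TYPE('v) R \<mm> (uniform_matroid k (k + 2))"
proof
  assume "representable_over TYPE('v) R \<mm> (uniform_matroid k (k + 2))"
  then obtain E V v where E: "finite (E :: nat set)" "card E = k + 2" "module R (V :: ('a, 'v) module)"
      "v \<in> E \<rightarrow> carrier V" "\<forall>I\<subseteq>E. modular_independent R \<mm> V v I \<longleftrightarrow> card I \<le> k"
    unfolding representable_uniform_iff by blast
  interpret chain_ring_module R \<mm> V
    using E(3) by (simp add: chain_ring_module_def local_chain_ring_axioms)
  show False
    using uniform_corank_2_bound[OF fin E(1,4,2)] E(2,5) assms(2) by auto
qed

end

theorem theorem5p5:
  fixes R :: "('r, 'm) ring_scheme" and \<mm> :: "'r set"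
    and F :: "('f, 'k) ring_scheme" and q \<nu> :: nat
  assumes "chain_ring R" and "finite (carrier R)"
    and "maximalideal \<mm> R"
    and "field F" and "finite (carrier F)" and "card (carrier F) = q"
    and "R Quot \<mm> \<simeq> F"
    and "nilpotency_index R \<mm> \<nu>"
    and "infinite (UNIV :: 'v set)"
  shows "(\<forall>n. representable_over TYPE('v) R \<mm> (uniform_matroid 2 n) \<longleftrightarrow> n \<le> q ^ \<nu> + q ^ (\<nu> - 1)) \<and>
    \<not> representable_over TYPE('v) R \<mm> (uniform_matroid 2 (q ^ \<nu> + q ^ (\<nu> - 1) + 1)) \<and>
    \<not> representable_over TYPE('v) R \<mm>
        (uniform_matroid (q ^ \<nu> + q ^ (\<nu> - 1) - 1) (q ^ \<nu> + q ^ (\<nu> - 1) + 1))"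
proof -
  interpret local_chain_ring R \<mm>
    using assms(1,3) by (simp add: local_chain_ring_def)
  have q: "card (carrier R) = q * card \<mm>"
    using card_carrier_eq_residue_field[OF assms(2,7)] assms(6) by simp
  note card = card_from_nilpotency_index[OF assms(2) q assms(8)]
  let ?N = "q ^ \<nu> + q ^ (\<nu> - 1)"
  have rank_2: "representable_over TYPE('v) R \<mm> (uniform_matroid 2 n) \<longleftrightarrow> n \<le> ?N" for n
    using representable_uniform_rank_2_iff[OF assms(2,9), of n] by (simp add: card)
  \<comment> \<open>Since \<open>?N\<close> is positive the subtraction is a true one, and the
    matroid takes the form \<open>uniform_matroid k (k + 2)\<close>.\<close>
  have "?N - 1 + 2 = ?N + 1"
    using card_carrier_maxideal_pos(1)[OF assms(2)] by (simp add: card)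
  then have "\<not> representable_over TYPE('v) R \<mm> (uniform_matroid (?N - 1) (?N + 1))"
    using not_representable_uniform_corank_2[OF assms(2), of "?N - 1", where 'v = 'v] by (simp add: card)
  with rank_2 show ?thesis by auto
qed

end
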